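(* If $A$ is a finite-dimensional C*-algebra, then $A = Z(A) + [A,A]$.
   Context: C*-algebras are over $\mathbb{C}$. $Z(A)$ is the center of $A$ and $[A,A]$ is the additive subgroup of $A$ generated by all additive commutators $ab-ba$ with $a,b\in A$. *)

theory Defs
  imports "HOL-Analysis.Analysis" "HOL-Computational_Algebra.Group_Closure" "HOL-Library.Set_Algebras"
begin

class scaleC =
  fixes scaleC :: "complex \<Rightarrow> 'a \<Rightarrow> 'a" (infixr "*\<^sub>C" 75)

class star =
  fixes star :: "'a \<Rightarrow> 'a"

text \<open>
  C*-algebras, not assumed to be unital. The real scalar multiplication inherited from
  \<^class>\<open>real_normed_algebra\<close> is the restriction of the complex one; associativity,
  distributivity and submultiplicativity of the norm come from that class, completeness
  from \<^class>\<open>banach\<close>.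
\<close>

class cstar_algebra = real_normed_algebra + banach + scaleC + star +
  assumes scaleR_scaleC: "r *\<^sub>R x = complex_of_real r *\<^sub>C x"
    and scaleC_add_right: "c *\<^sub>C (x + y) = c *\<^sub>C x + c *\<^sub>C y"
    and scaleC_add_left: "(c + d) *\<^sub>C x = c *\<^sub>C x + d *\<^sub>C x"
    and scaleC_scaleC: "c *\<^sub>C d *\<^sub>C x = (c * d) *\<^sub>C x"
    and scaleC_one: "1 *\<^sub>C x = x"
    and mult_scaleC_left: "(c *\<^sub>C x) * y = c *\<^sub>C (x * y)"
    and mult_scaleC_right: "x * (c *\<^sub>C y) = c *\<^sub>C (x * y)"
    and norm_scaleC: "norm (c *\<^sub>C x) = cmod c * norm x"
    and star_add: "star (x + y) = star x + star y"
    and star_scaleC: "star (c *\<^sub>C x) = cnj c *\<^sub>C star x"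
    and star_mult: "star (x * y) = star y * star x"
    and star_star: "star (star x) = x"
    and cstar_identity: "norm (star x * x) = (norm x)\<^sup>2"

definition center :: "'a::ring set" where
  "center = {z. \<forall>a. z * a = a * z}"

definition commutator_subgroup :: "'a::ring set" where
  "commutator_subgroup = group_closure {a * b - b * a | a b. True}"

end

theory Submission
  imports Defs
begin

text \<open>
  The decomposition holds for every finite-dimensional semiprime algebra over a field of
  characteristic \<open>0\<close>, and a C*-algebra is semiprime because the C*-identity forces
  \<open>x * star x * x \<noteq> 0\<close> for \<open>x \<noteq> 0\<close>. No structure theorem is used; the proof rests on the
  regular trace \<open>\<tau>\<close>, which sends \<open>x\<close> to the trace of left multiplication by \<open>x\<close>.

  The bilinear form \<open>\<tau> (x * y)\<close> is symmetric. It is also nondegenerate: its radical is a right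
  ideal, and in a semiprime algebra a nonzero right ideal contains an idempotent \<open>e \<noteq> 0\<close>
  (Brauer's lemma), whereas \<open>\<tau> e\<close> is the rank of left multiplication by \<open>e\<close> and so does not
  vanish in characteristic \<open>0\<close>. Hence a basis \<open>b\<^sub>1, \<dots>, b\<^sub>n\<close> has a dual basis
  \<open>d\<^sub>1, \<dots>, d\<^sub>n\<close> with respect to this form. Two facts about the pair of bases suffice:

  \<^item> \<open>\<Sum> d\<^sub>i * x * b\<^sub>i\<close> is central for every \<open>x\<close>, as for any symmetric nondegenerate
    associative form;

  \<^item> \<open>c = \<Sum> b\<^sub>i * d\<^sub>i\<close> is a unit element, because writing the trace of left multiplication by
    \<open>x\<close> in the two bases gives \<open>\<tau> x = \<tau> (x * c)\<close>, and the form is nondegenerate.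

  The decomposition is then explicit:
  \<open>x = x * c = \<Sum> d\<^sub>i * x * b\<^sub>i + \<Sum> ((x * b\<^sub>i) * d\<^sub>i - d\<^sub>i * (x * b\<^sub>i))\<close>.
\<close>

section \<open>Finite-dimensional algebras and the regular trace\<close>

text \<open>
  The algebra carries no unit of its own: C*-algebras here need not be unital, and the existence
  of a unit comes out of the trace form.
\<close>

locale finite_dimensional_algebra =
  finite_dimensional_vector_space scale Basis
  for scale :: "'k::field \<Rightarrow> 'a::ring \<Rightarrow> 'a" (infixr "\<cdot>" 75) and Basis :: "'a set" +
  assumes scale_mult_left: "(c \<cdot> x) * y = c \<cdot> (x * y)"
    and scale_mult_right: "x * (c \<cdot> y) = c \<cdot> (x * y)"
begin

abbreviation coord :: "'a \<Rightarrow> 'a \<Rightarrow> 'k" where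
  "coord b x \<equiv> representation Basis x b"

lemma in_span_Basis [simp]: "x \<in> span Basis"
  by (simp add: span_Basis)

lemma coord_add: "coord b (x + y) = coord b x + coord b y"
  by (simp add: representation_add independent_Basis)

lemma coord_scale: "coord b (c \<cdot> x) = c * coord b x"
  by (simp add: representation_scale independent_Basis)

lemma coord_sum: "coord b (\<Sum>i\<in>I. f i) = (\<Sum>i\<in>I. coord b (f i))"
  by (simp add: representation_sum independent_Basis)

lemma coord_Basis: "b \<in> Basis \<Longrightarrow> coord c b = (if c = b then 1 else 0)"
  by (auto simp: representation_basis independent_Basis)

lemma sum_coord_scale: "(\<Sum>b\<in>Basis. coord b x \<cdot> b) = x"
  by (rule sum_representation_eq) (auto simp: independent_Basis finite_Basis)

lemma coord_mult_expand: "coord b (x * y) = (\<Sum>c\<in>Basis. coord c y * coord b (x * c))"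
proof -
  have "x * y = x * (\<Sum>c\<in>Basis. coord c y \<cdot> c)"
    by (simp only: sum_coord_scale)
  also have "\<dots> = (\<Sum>c\<in>Basis. coord c y \<cdot> (x * c))"
    by (simp add: sum_distrib_left scale_mult_right)
  finally show ?thesis
    by (simp only: coord_sum coord_scale)
qed

definition regular_trace :: "'a \<Rightarrow> 'k" where
  "regular_trace x = (\<Sum>b\<in>Basis. coord b (x * b))"

lemma regular_trace_add: "regular_trace (x + y) = regular_trace x + regular_trace y"
  by (simp add: regular_trace_def distrib_right coord_add sum.distrib)

lemma regular_trace_scale: "regular_trace (c \<cdot> x) = c * regular_trace x"
  by (simp add: regular_trace_def scale_mult_left coord_scale sum_distrib_left)

lemma regular_trace_diff: "regular_trace (x - y) = regular_trace x - regular_trace y"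
  using regular_trace_add[of "x - y" y] by (simp add: eq_diff_eq)

lemma regular_trace_sum: "regular_trace (\<Sum>i\<in>I. f i) = (\<Sum>i\<in>I. regular_trace (f i))"
proof (induction I rule: infinite_finite_induct)
  case empty
  show ?case using regular_trace_diff[of 0 0] by simp
next
  case (infinite I)
  show ?case using infinite regular_trace_diff[of 0 0] by simp
qed (simp add: regular_trace_add)

text \<open>
  In coordinates both sides are the same double sum over the matrix entries of the two left
  multiplications, with the order of summation exchanged.
\<close>

lemma regular_trace_commute: "regular_trace (x * y) = regular_trace (y * x)"
proof -
  have expand: "regular_trace (x * y)
      = (\<Sum>b\<in>Basis. \<Sum>c\<in>Basis. coord c (y * b) * coord b (x * c))" for x y
    unfolding regular_trace_def mult.assoc by (rule sum.cong[OF refl coord_mult_expand])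
  show ?thesis
    unfolding expand by (subst sum.swap) (simp add: mult.commute)
qed

text \<open>
  The trace of a projection is its rank. Instead of changing to a basis adapted to the
  projection, factor left multiplication by \<open>e\<close> through a basis \<open>C\<close> of its range and
  exchange the sums over the two bases; as \<open>e\<close> fixes each element of \<open>C\<close>, every \<open>c \<in> C\<close>
  contributes \<open>1\<close>.
\<close>

lemma regular_trace_idempotent:
  assumes idem: "e * e = e"
  shows "regular_trace e = of_nat (dim (range ((*) e)))"
proof -
  let ?S = "range ((*) e)"
  have "subspace ?S"
  proof (rule subspaceI)
    show "0 \<in> ?S" by (rule image_eqI[of _ _ 0]) auto
    show "x + y \<in> ?S" if "x \<in> ?S" "y \<in> ?S" for x y
      using that by (auto simp flip: distrib_left)
    show "c \<cdot> x \<in> ?S" if "x \<in> ?S" for c x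
      using that by (auto simp flip: scale_mult_right)
  qed
  obtain C where C: "C \<subseteq> ?S" "independent C" "?S \<subseteq> span C" "card C = dim ?S"
    using basis_exists by blast
  have fin: "finite C"
    using C(2) by (rule finiteI_independent)
  have span: "e * x \<in> span C" for x
    using C(3) by auto
  have fixed: "e * c = c" if "c \<in> C" for c
    using that C(1) by (auto simp: idem simp flip: mult.assoc)
  have expand: "e * x = (\<Sum>c\<in>C. representation C (e * x) c \<cdot> c)" for x
    using sum_representation_eq[OF C(2) span fin subset_refl] by simp
  have "regular_trace e
      = (\<Sum>b\<in>Basis. \<Sum>c\<in>C. representation C (e * b) c * coord b c)"
    unfolding regular_trace_def
    by (rule sum.cong[OF refl], subst expand) (simp add: coord_sum coord_scale)
  also have "\<dots> = (\<Sum>c\<in>C. \<Sum>b\<in>Basis. coord b c * representation C (e * b) c)"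
    by (subst sum.swap) (simp add: mult.commute)
  also have "\<dots> = (\<Sum>c\<in>C. representation C c c)"
  proof (rule sum.cong[OF refl])
    fix c assume c: "c \<in> C"
    \<comment> \<open>The inner sum is the \<open>c\<close>-coordinate of \<open>e * c = c\<close>, with \<open>c\<close> expanded in \<open>Basis\<close>.\<close>
    have "c = e * (\<Sum>b\<in>Basis. coord b c \<cdot> b)"
      by (simp only: sum_coord_scale fixed[OF c])
    also have "\<dots> = (\<Sum>b\<in>Basis. coord b c \<cdot> (e * b))"
      by (simp add: sum_distrib_left scale_mult_right)
    finally have "representation C c c
        = representation C (\<Sum>b\<in>Basis. coord b c \<cdot> (e * b)) c"
      by simp
    also have "\<dots> = (\<Sum>b\<in>Basis. coord b c * representation C (e * b) c)"
      by (simp add: representation_sum representation_scale C(2) span span_scale)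
    finally show "(\<Sum>b\<in>Basis. coord b c * representation C (e * b) c) = representation C c c"
      by simp
  qed
  also have "\<dots> = of_nat (card C)"
    by (simp add: representation_basis C(2))
  finally show ?thesis
    by (simp add: C(4))
qed

section \<open>Idempotents in right ideals of semiprime algebras\<close>

definition right_ideal :: "'a set \<Rightarrow> bool" where
  "right_ideal I \<longleftrightarrow> subspace I \<and> (\<forall>x\<in>I. \<forall>a. x * a \<in> I)"

lemma right_ideal_image:
  assumes "right_ideal I"
  shows "right_ideal ((*) u ` I)"
proof -
  have sub: "subspace I" and mult: "\<And>x a. x \<in> I \<Longrightarrow> x * a \<in> I"
    using assms by (auto simp: right_ideal_def)
  have "subspace ((*) u ` I)"
  proof (rule subspaceI)
    show "0 \<in> (*) u ` I"
      by (rule image_eqI[of _ _ 0]) (auto intro: subspace_0[OF sub])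
    show "x + y \<in> (*) u ` I" if "x \<in> (*) u ` I" "y \<in> (*) u ` I" for x y
      using that by (auto simp flip: distrib_left intro: subspace_add[OF sub])
    show "c \<cdot> x \<in> (*) u ` I" if "x \<in> (*) u ` I" for c x
      using that by (auto simp flip: scale_mult_right intro: subspace_scale[OF sub])
  qed
  then show ?thesis
    by (auto simp: right_ideal_def mult.assoc intro: mult)
qed

lemma right_ideal_annihilator:
  assumes "right_ideal I"
  shows "right_ideal {z \<in> I. u * z = 0}"
proof -
  have "subspace {z \<in> I. u * z = 0}"
    using assms
    by (auto simp: right_ideal_def subspace_def distrib_left scale_mult_right)
  then show ?thesis
    using assms by (auto simp: right_ideal_def simp flip: mult.assoc)
qed

lemma minimal_right_ideal_exists:
  assumes "right_ideal R" "R \<noteq> {0}"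
  obtains I where "right_ideal I" "I \<subseteq> R" "I \<noteq> {0}"
    "\<And>J. right_ideal J \<Longrightarrow> J \<subseteq> I \<Longrightarrow> J \<noteq> {0} \<Longrightarrow> J = I"
proof -
  let ?P = "\<lambda>I. right_ideal I \<and> I \<subseteq> R \<and> I \<noteq> {0}"
  obtain I where I: "?P I" and least: "\<And>J. ?P J \<Longrightarrow> dim I \<le> dim J"
    using ex_has_least_nat[of ?P R dim] assms by blast
  have "J = I" if J: "right_ideal J" "J \<subseteq> I" "J \<noteq> {0}" for J
  proof (rule subspace_dim_equal[OF _ _ J(2)])
    show "dim I \<le> dim J"
      using least J I by blast
    show "subspace J" "subspace I"
      using J(1) I by (auto simp: right_ideal_def)
  qed
  then show ?thesis
    using that I by blast
qed

text \<open>
  Brauer's lemma. In a minimal right ideal \<open>I \<subseteq> R\<close>, semiprimeness provides \<open>u\<close> with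
  \<open>u * I \<noteq> 0\<close>. By minimality, left multiplication by \<open>u\<close> maps \<open>I\<close> onto itself and has trivial
  kernel there. So \<open>u = u * e\<close> for some \<open>e \<in> I\<close>, and \<open>u * (e * e - e) = 0\<close> makes \<open>e\<close>
  idempotent.
\<close>

lemma idempotent_in_right_ideal:
  assumes semiprime: "\<And>x :: 'a. x \<noteq> 0 \<Longrightarrow> \<exists>y. x * y * x \<noteq> 0"
    and R: "right_ideal R" "R \<noteq> {0}"
  obtains e where "e \<in> R" "e \<noteq> 0" "e * e = e"
proof -
  obtain I where I: "right_ideal I" "I \<subseteq> R" "I \<noteq> {0}"
    and minimal: "\<And>J. right_ideal J \<Longrightarrow> J \<subseteq> I \<Longrightarrow> J \<noteq> {0} \<Longrightarrow> J = I"
    using minimal_right_ideal_exists[OF R] by metis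
  have sub: "subspace I" and mult: "\<And>x a. x \<in> I \<Longrightarrow> x * a \<in> I"
    using I(1) by (auto simp: right_ideal_def)
  obtain x where x: "x \<in> I" "x \<noteq> 0"
    using I(3) subspace_0[OF sub] by blast
  obtain y where y: "x * y * x \<noteq> 0"
    using semiprime[OF x(2)] by blast
  define u where "u = x * y"
  have u: "u \<in> I" "u * x \<noteq> 0" "u \<noteq> 0"
    using x(1) y mult by (auto simp: u_def)
  have "(*) u ` I = I"
    using u x(1) mult by (intro minimal right_ideal_image I(1)) auto
  then obtain e where e: "e \<in> I" "u * e = u"
    using u(1) by (metis imageE)
  have "{z \<in> I. u * z = 0} = {0}"
    using minimal[OF right_ideal_annihilator[OF I(1)], of u] u(2) x(1) by blast
  moreover have "e * e - e \<in> {z \<in> I. u * z = 0}"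
    using e mult by (auto simp: right_diff_distrib intro: subspace_diff[OF sub] simp flip: mult.assoc)
  ultimately have "e * e = e"
    by auto
  moreover have "e \<noteq> 0"
    using e(2) u(3) by auto
  ultimately show ?thesis
    using that e(1) I(2) by blast
qed

section \<open>The Casimir element of the trace form\<close>

text \<open>
  A nonzero idempotent \<open>e\<close> in the radical of the form would satisfy \<open>\<tau> e = \<tau> (e * e) = 0\<close>,
  although \<open>\<tau> e\<close> is the rank of left multiplication by \<open>e\<close>. This is where characteristic \<open>0\<close>
  enters.
\<close>

lemma regular_trace_nondegenerate:
  assumes char0: "CHAR('k) = 0"
    and semiprime: "\<And>x :: 'a. x \<noteq> 0 \<Longrightarrow> \<exists>y. x * y * x \<noteq> 0"
    and x: "\<And>y. regular_trace (x * y) = 0"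
  shows "x = 0"
proof (rule ccontr)
  assume "x \<noteq> 0"
  define R where "R = {x. \<forall>y. regular_trace (x * y) = 0}"
  have "subspace R"
    using regular_trace_diff[of 0 0]
    by (intro subspaceI)
      (auto simp: R_def distrib_right scale_mult_left regular_trace_add regular_trace_scale)
  then have "right_ideal R"
    by (auto simp: right_ideal_def R_def mult.assoc)
  moreover have "R \<noteq> {0}"
    using x \<open>x \<noteq> 0\<close> by (auto simp: R_def)
  ultimately obtain e where e: "e \<in> R" "e \<noteq> 0" "e * e = e"
    using idempotent_in_right_ideal[OF semiprime] by blast
  have "regular_trace (e * e) = 0"
    using e(1) by (simp add: R_def)
  then have "of_nat (dim (range ((*) e))) = (0 :: 'k)"
    using regular_trace_idempotent[OF e(3)] e(3) by simp
  then have "range ((*) e) \<subseteq> {0}"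
    using char0 by (simp add: of_nat_eq_0_iff_char_dvd)
  then have "e * e = 0"
    by blast
  then show False
    using e(2,3) by simp
qed

text \<open>
  Nondegeneracy says that the linear map \<open>\<Phi>\<close> taking \<open>y\<close> to the element with coordinates
  \<open>\<tau> (y * b)\<close> is injective, hence bijective; the dual basis is the preimage of the basis.
  The two conclusions are the expansions of an arbitrary element in the basis and in its dual.
\<close>

lemma dual_basis_exists:
  assumes nondeg: "\<And>x. (\<And>y. regular_trace (x * y) = 0) \<Longrightarrow> x = 0"
  obtains d where
    "\<And>b y. b \<in> Basis \<Longrightarrow> coord b y = regular_trace (d b * y)"
    "\<And>y. (\<Sum>b\<in>Basis. regular_trace (y * b) \<cdot> d b) = y"
proof -
  define \<Phi> where "\<Phi> y = (\<Sum>b\<in>Basis. regular_trace (y * b) \<cdot> b)" for y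
  have lin: "Vector_Spaces.linear scale scale \<Phi>"
    by (unfold_locales)
      (simp_all add: \<Phi>_def distrib_right scale_mult_left regular_trace_add regular_trace_scale
        scale_left_distrib sum.distrib scale_sum_right)
  interpret \<Phi>: Vector_Spaces.linear scale scale \<Phi> by (fact lin)
  have coord_\<Phi>: "coord b (\<Phi> y) = regular_trace (y * b)" if "b \<in> Basis" for b y
    using that by (simp add: \<Phi>_def coord_sum coord_scale coord_Basis finite_Basis
        if_distrib[of "\<lambda>x. _ * x"] cong: if_cong)
  have pairing: "regular_trace (y * z) = (\<Sum>b\<in>Basis. coord b z * regular_trace (y * b))" for y z
  proof -
    have "regular_trace (y * z) = regular_trace (y * (\<Sum>b\<in>Basis. coord b z \<cdot> b))"
      by (simp only: sum_coord_scale)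
    then show ?thesis
      by (simp add: sum_distrib_left scale_mult_right regular_trace_sum regular_trace_scale)
  qed
  have inj: "inj \<Phi>"
    unfolding \<Phi>.inj_iff_eq_0
  proof (intro allI impI)
    fix y assume "\<Phi> y = 0"
    then have "regular_trace (y * b) = 0" if "b \<in> Basis" for b
      using coord_\<Phi>[OF that, of y] by (simp add: representation_zero)
    then show "y = 0"
      by (intro nondeg, subst pairing) simp
  qed
  then have surj: "surj \<Phi>"
    using lin linear_inj_imp_surj by blast
  define d where "d b = inv \<Phi> b" for b
  have \<Phi>_d: "\<Phi> (d b) = b" for b
    by (simp add: d_def surj_f_inv_f[OF surj])
  have orth: "regular_trace (d b * c) = (if c = b then 1 else 0)"
    if "b \<in> Basis" "c \<in> Basis" for b c
    using coord_\<Phi>[OF that(2), of "d b"] that by (simp add: \<Phi>_d coord_Basis)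
  show ?thesis
  proof (rule that)
    show "coord b y = regular_trace (d b * y)" if "b \<in> Basis" for b y
      using that by (subst pairing)
        (simp add: orth finite_Basis if_distrib[of "\<lambda>x. _ * x"] cong: if_cong)
    show "(\<Sum>b\<in>Basis. regular_trace (y * b) \<cdot> d b) = y" for y
      by (rule injD[OF inj]) (simp add: \<Phi>.sum \<Phi>.scale \<Phi>_d \<Phi>_def[of y])
  qed
qed

text \<open>
  The Casimir construction turns \<open>x\<close> into the central element \<open>\<Sum> d\<^sub>i * x * b\<^sub>i\<close>. For the
  regular trace it is normalised so that \<open>\<Sum> b\<^sub>i * d\<^sub>i = 1\<close>; hence cyclically moving \<open>d\<^sub>i\<close>
  from the right of \<open>x * b\<^sub>i\<close> to its left changes \<open>x\<close> only by commutators.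
\<close>

theorem center_plus_commutator_subgroup:
  assumes char0: "CHAR('k) = 0"
    and semiprime: "\<And>x :: 'a. x \<noteq> 0 \<Longrightarrow> \<exists>y. x * y * x \<noteq> 0"
  shows "(UNIV :: 'a set) = center + commutator_subgroup"
proof -
  have nondeg: "x = 0" if "\<And>y. regular_trace (x * y) = 0" for x
    using regular_trace_nondegenerate[OF char0 semiprime that] by simp
  obtain d where coord_d: "\<And>b y. b \<in> Basis \<Longrightarrow> coord b y = regular_trace (d b * y)"
    and expand_d: "\<And>y. (\<Sum>b\<in>Basis. regular_trace (y * b) \<cdot> d b) = y"
    using dual_basis_exists[OF nondeg] by metis
  have unit: "x * (\<Sum>b\<in>Basis. b * d b) = x" for x
  proof -
    define c where "c = (\<Sum>b\<in>Basis. b * d b)"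
    have trace_c: "regular_trace (z * c) = regular_trace z" for z
    proof -
      have "regular_trace z = (\<Sum>b\<in>Basis. regular_trace (d b * (z * b)))"
        by (simp add: regular_trace_def[of z] coord_d)
      also have "\<dots> = (\<Sum>b\<in>Basis. regular_trace ((z * b) * d b))"
        by (simp only: regular_trace_commute)
      finally show ?thesis
        by (simp add: c_def sum_distrib_left regular_trace_sum mult.assoc)
    qed
    have "x * c - x = 0"
    proof (rule nondeg)
      fix y
      have "regular_trace ((x * c - x) * y) = regular_trace (y * (x * c - x))"
        by (rule regular_trace_commute)
      also have "\<dots> = regular_trace ((y * x) * c) - regular_trace (y * x)"
        by (simp add: right_diff_distrib regular_trace_diff mult.assoc)
      finally show "regular_trace ((x * c - x) * y) = 0"
        by (simp add: trace_c)
    qed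
    then show ?thesis
      by (simp add: c_def)
  qed
  have central: "(\<Sum>b\<in>Basis. d b * x * b) \<in> center" for x
  proof -
    have "(\<Sum>b\<in>Basis. d b * x * b) * a = a * (\<Sum>b\<in>Basis. d b * x * b)" for a
    proof -
      \<comment> \<open>Expand \<open>b * a\<close> in the basis and collect the terms as the expansion of \<open>a * d c\<close> in the
        dual basis; cyclicity of the trace identifies the two families of coefficients.\<close>
      have "(\<Sum>b\<in>Basis. d b * x * b) * a
          = (\<Sum>b\<in>Basis. d b * x * (\<Sum>c\<in>Basis. coord c (b * a) \<cdot> c))"
        by (simp only: sum_coord_scale sum_distrib_right mult.assoc)
      also have "\<dots> = (\<Sum>b\<in>Basis. \<Sum>c\<in>Basis. regular_trace (d c * (b * a)) \<cdot> (d b * x * c))"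
        by (simp add: sum_distrib_left scale_mult_right coord_d)
      also have "\<dots> = (\<Sum>c\<in>Basis. \<Sum>b\<in>Basis. regular_trace (d c * (b * a)) \<cdot> (d b * x * c))"
        by (rule sum.swap)
      also have "\<dots> = (\<Sum>c\<in>Basis. \<Sum>b\<in>Basis. regular_trace (a * d c * b) \<cdot> (d b * x * c))"
        by (simp only: mult.assoc regular_trace_commute[of a])
      also have "\<dots> = (\<Sum>c\<in>Basis. (\<Sum>b\<in>Basis. regular_trace (a * d c * b) \<cdot> d b) * x * c)"
        by (simp add: sum_distrib_right scale_mult_left)
      also have "\<dots> = a * (\<Sum>b\<in>Basis. d b * x * b)"
        unfolding expand_d by (simp add: sum_distrib_left mult.assoc)
      finally show ?thesis .
    qed
    then show ?thesis
      by (simp add: center_def)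
  qed
  have commutators: "(\<Sum>b\<in>B. (x * b) * d b - d b * (x * b)) \<in> commutator_subgroup" for x :: 'a and B
  proof (induction B rule: infinite_finite_induct)
    case (insert b B)
    have "(x * b) * d b - d b * (x * b) \<in> commutator_subgroup"
      unfolding commutator_subgroup_def by (rule group_closure.base) blast
    then show ?case
      using insert by (auto simp: commutator_subgroup_def intro: group_closure_add)
  qed (simp_all add: commutator_subgroup_def)
  have "x \<in> center + commutator_subgroup" for x :: 'a
  proof -
    have "x = (\<Sum>b\<in>Basis. d b * x * b) + (\<Sum>b\<in>Basis. (x * b) * d b - d b * (x * b))"
      using unit[of x] by (simp add: sum_subtractf sum_distrib_left mult.assoc)
    then show ?thesis
      using set_plus_intro[OF central[of x] commutators[of x Basis]] by simp
  qed
  then show ?thesis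
    by auto
qed

end

section \<open>C*-algebras\<close>

text \<open>
  If \<open>x * star x * x = 0\<close>, the self-adjoint element \<open>star x * x\<close> has square \<open>0\<close>, and the
  C*-identity applied twice gives \<open>x = 0\<close>.
\<close>

lemma cstar_algebra_semiprime:
  fixes x :: "'a::cstar_algebra"
  assumes "x \<noteq> 0"
  shows "x * star x * x \<noteq> 0"
proof
  assume "x * star x * x = 0"
  then have "star (star x * x) * (star x * x) = 0"
    by (simp add: star_mult star_star mult.assoc)
  then have "norm (star x * x) = 0"
    using cstar_identity[of "star x * x"] by simp
  then show False
    using assms cstar_identity[of x] by simp
qed

theorem corollary2p4:
  assumes "\<exists>B :: 'a::cstar_algebra set.
    finite_dimensional_vector_space (scaleC :: complex \<Rightarrow> 'a \<Rightarrow> 'a) B"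
  shows "(UNIV :: 'a set) = center + commutator_subgroup"
proof -
  obtain B :: "'a set"
    where "finite_dimensional_vector_space (scaleC :: complex \<Rightarrow> 'a \<Rightarrow> 'a) B"
    using assms by blast
  then interpret finite_dimensional_vector_space "scaleC :: complex \<Rightarrow> 'a \<Rightarrow> 'a" B .
  interpret finite_dimensional_algebra "scaleC :: complex \<Rightarrow> 'a \<Rightarrow> 'a" B
    by unfold_locales (rule mult_scaleC_left mult_scaleC_right)+
  show ?thesis
    by (rule center_plus_commutator_subgroup) (auto dest: cstar_algebra_semiprime)
qed

end
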